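(* For all $p,q,r\ge 0$ with $n=p+q+r\ge 1$: (i) $\Gamma^{0}_{p,q,r}=\tilde{\Gamma}^{0}_{p,q,r}=\mathcal{G}^{\times}_{p,q,r}$; (ii) $\Gamma^{n}_{p,q,r}=\mathcal{G}^{\times}_{p,q,r}$ if $n$ is odd, and $\Gamma^{n}_{p,q,r}=\tilde{\Gamma}^{n}_{p,q,r}=\mathrm{P}^{\pm\mathrm{rad}}_{p,q,r}$ if $n$ is even; (iii) $\check{\Gamma}^{0}_{p,q,r}=\mathrm{P}^{\pm}_{p,q,r}$; (iv) $\check{\Gamma}^{n}_{p,q,r}=\tilde{\Gamma}^{n}_{p,q,r}=\mathrm{P}^{\pm\mathrm{rad}}_{p,q,r}$ if $n$ is odd, and $\check{\Gamma}^{n}_{p,q,r}=\mathcal{G}^{\times}_{p,q,r}$ if $n$ is even.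
   Context: Let $\mathbb{F}=\mathbb{R}$ or $\mathbb{F}=\mathbb{C}$, let $p,q,r\ge 0$ be integers and $n=p+q+r\ge 1$. $\mathcal{G}_{p,q,r}$ denotes the (Clifford) geometric algebra: the unital associative $\mathbb{F}$-algebra of dimension $2^n$ with identity $e$ and generators $e_1,\dots,e_n$ satisfying $e_ae_b+e_be_a=2\eta_{ab}e$, where $\eta$ is the diagonal matrix whose diagonal is $p$ times $1$, then $q$ times $-1$, then $r$ times $0$ (if $\mathbb{F}=\mathbb{R}$), or $p+q$ times $1$, then $r$ times $0$ (if $\mathbb{F}=\mathbb{C}$). A basis is given by $e_{a_1\ldots a_k}:=e_{a_1}\cdots e_{a_k}$, $a_1<\dots<a_k$, $0\le k\le n$ (the empty product being $e$); $\mathcal{G}^k_{p,q,r}$ (grade $k$) is the span of those with $k$ indices, and $\mathcal{G}^0=\mathcal{G}^0_{p,q,r}=\mathbb{F}e$. The grade involution $U\mapsto\widehat U$ is the algebra automorphism with $\widehat{e_a}=-e_a$. $\mathcal{G}^{(k)}_{p,q,r}=\{U:\widehat U=(-1)^kU\}$, $k=0,1$ (even and odd subspaces). $\mathrm{rad}\,\mathcal{G}_{p,q,r}$ is the Jacobson radical of $\mathcal{G}_{p,q,r}$; it is the span of the basis elements $e_{a_1\ldots a_k}$ containing at least one index from $\{p+q+1,\dots,n\}$ (it is $\{0\}$ if $r=0$). For a subset $A\subseteq\mathcal{G}_{p,q,r}$, $A^\times$ denotes the set of elements of $A$ invertible in $\mathcal{G}_{p,q,r}$. A product of subsets is the set of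 products of their elements. Groups: $\mathrm{P}^{\pm}_{p,q,r}:=\mathcal{G}^{(0)\times}_{p,q,r}\cup\mathcal{G}^{(1)\times}_{p,q,r}$ and $\mathrm{P}^{\pm\mathrm{rad}}_{p,q,r}:=\mathrm{P}^{\pm}_{p,q,r}(\mathcal{G}^{0}\oplus\mathrm{rad}\,\mathcal{G}_{p,q,r})^{\times}$. For $T\in\mathcal{G}^\times_{p,q,r}$ and $U=U_0+U_1\in\mathcal{G}_{p,q,r}$ with $U_0\in\mathcal{G}^{(0)}_{p,q,r}$, $U_1\in\mathcal{G}^{(1)}_{p,q,r}$, set $\mathrm{ad}_T(U)=TUT^{-1}$, $\check{\mathrm{ad}}_T(U)=\widehat{T}UT^{-1}$, $\tilde{\mathrm{ad}}_T(U)=TU_0T^{-1}+\widehat{T}U_1T^{-1}$. For $0\le k\le n$: $\Gamma^{k}_{p,q,r}:=\{T\in\mathcal{G}^\times_{p,q,r}:\mathrm{ad}_T(\mathcal{G}^{k}_{p,q,r})\subseteq\mathcal{G}^{k}_{p,q,r}\}$, $\check{\Gamma}^{k}_{p,q,r}:=\{T\in\mathcal{G}^\times_{p,q,r}:\check{\mathrm{ad}}_T(\mathcal{G}^{k}_{p,q,r})\subseteq\mathcal{G}^{k}_{p,q,r}\}$, $\tilde{\Gamma}^{k}_{p,q,r}:=\{T\in\mathcal{G}^\times_{p,q,r}:\tilde{\mathrm{ad}}_T(\mathcal{G}^{k}_{p,q,r})\subseteq\mathcal{G}^{k}_{p,q,r}\}$. *)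

theory Defs
  imports Complex_Main "HOL-Library.Set_Algebras"
begin

definition inverses :: "'a::ring_1 \<Rightarrow> 'a \<Rightarrow> bool"
  where "inverses x y \<longleftrightarrow> x * y = 1 \<and> y * x = 1"

text \<open>The elements of \<open>A\<close> that are invertible in the whole ring; the inverse need not lie in \<open>A\<close>.\<close>

definition units_in :: "'a::ring_1 set \<Rightarrow> 'a set"
  where "units_in A = {x \<in> A. \<exists>y. inverses x y}"

definition inv_of :: "'a::ring_1 \<Rightarrow> 'a"
  where "inv_of x = (THE y. inverses x y)"

definition left_ideal :: "'a::ring_1 set \<Rightarrow> bool"
  where "left_ideal I \<longleftrightarrow>
    0 \<in> I \<and> (\<forall>x\<in>I. \<forall>y\<in>I. x + y \<in> I) \<and> (\<forall>a. \<forall>x\<in>I. a * x \<in> I)"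

definition maximal_left_ideal :: "'a::ring_1 set \<Rightarrow> bool"
  where "maximal_left_ideal M \<longleftrightarrow>
    left_ideal M \<and> M \<noteq> UNIV \<and> (\<forall>I. left_ideal I \<and> M \<subseteq> I \<longrightarrow> I = M \<or> I = UNIV)"

definition jacobson_radical :: "'a::ring_1 set"
  where "jacobson_radical = \<Inter>{M. maximal_left_ideal M}"


text \<open>
  The algebra is the whole type \<open>'a\<close>, with identity \<open>1\<close>. The generators are \<open>e 1, \<dots>, e n\<close>;
  values of \<open>e\<close> and \<open>\<eta>\<close> at indices outside \<open>{1..n}\<close> are irrelevant.
  As \<open>dim\<close> is \<open>0\<close> for a space without finite basis, \<open>dimension\<close> includes finite-dimensionality.
\<close>

locale geometric_algebra = vector_space scale
  for scale :: "'f::field \<Rightarrow> 'a::ring_1 \<Rightarrow> 'a" (infixr \<open>*s\<close> 75) +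
  fixes n :: nat and \<eta> :: "nat \<Rightarrow> nat \<Rightarrow> 'f" and e :: "nat \<Rightarrow> 'a"
  assumes scale_mult_left: "(c *s x) * y = c *s (x * y)"
    and scale_mult_right: "x * (c *s y) = c *s (x * y)"
    and dimension: "dim UNIV = 2 ^ n"
    and generated: "subspace S \<Longrightarrow> 1 \<in> S \<Longrightarrow> (\<And>x y. x \<in> S \<Longrightarrow> y \<in> S \<Longrightarrow> x * y \<in> S)
      \<Longrightarrow> e ` {1..n} \<subseteq> S \<Longrightarrow> S = UNIV"
    and relations: "a \<in> {1..n} \<Longrightarrow> b \<in> {1..n} \<Longrightarrow> e a * e b + e b * e a = (2 * \<eta> a b) *s 1"
begin

definition basis_elem :: "nat set \<Rightarrow> 'a"
  where "basis_elem A = prod_list (map e (sorted_list_of_set A))"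

definition grade :: "nat \<Rightarrow> 'a set"
  where "grade k = span {basis_elem A | A. A \<subseteq> {1..n} \<and> card A = k}"

definition is_grade_involution :: "('a \<Rightarrow> 'a) \<Rightarrow> bool"
  where "is_grade_involution h \<longleftrightarrow>
    bij h \<and> Vector_Spaces.linear scale scale h \<and> h 1 = 1 \<and> (\<forall>x y. h (x * y) = h x * h y) \<and>
    (\<forall>a\<in>{1..n}. h (e a) = - e a)"

definition hat :: "'a \<Rightarrow> 'a"
  where "hat = (THE h. is_grade_involution h)"

definition parity_subspace :: "nat \<Rightarrow> 'a set"
  where "parity_subspace k = {U. hat U = (- 1) ^ k * U}"

definition even_part :: "'a \<Rightarrow> 'a"
  where "even_part U = (THE V. V \<in> parity_subspace 0 \<and> U - V \<in> parity_subspace 1)"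

definition odd_part :: "'a \<Rightarrow> 'a"
  where "odd_part U = U - even_part U"

definition ad :: "'a \<Rightarrow> 'a \<Rightarrow> 'a"
  where "ad T U = T * U * inv_of T"

definition ad_check :: "'a \<Rightarrow> 'a \<Rightarrow> 'a"
  where "ad_check T U = hat T * U * inv_of T"

definition ad_tilde :: "'a \<Rightarrow> 'a \<Rightarrow> 'a"
  where "ad_tilde T U = T * even_part U * inv_of T + hat T * odd_part U * inv_of T"

definition Gam :: "nat \<Rightarrow> 'a set"
  where "Gam k = {T \<in> units_in UNIV. ad T ` grade k \<subseteq> grade k}"

definition Gam_check :: "nat \<Rightarrow> 'a set"
  where "Gam_check k = {T \<in> units_in UNIV. ad_check T ` grade k \<subseteq> grade k}"

definition Gam_tilde :: "nat \<Rightarrow> 'a set"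
  where "Gam_tilde k = {T \<in> units_in UNIV. ad_tilde T ` grade k \<subseteq> grade k}"

definition Ppm :: "'a set"
  where "Ppm = units_in (parity_subspace 0) \<union> units_in (parity_subspace 1)"

text \<open>The sum and the product here are the elementwise operations on subsets.\<close>

definition Ppm_rad :: "'a set"
  where "Ppm_rad = Ppm * units_in (grade 0 + jacobson_radical)"

end

text \<open>Only \<open>a, b \<in> {1..n}\<close> with \<open>n = p + q + r\<close> are relevant.\<close>

definition eta_real :: "nat \<Rightarrow> nat \<Rightarrow> nat \<Rightarrow> nat \<Rightarrow> real"
  where "eta_real p q a b =
    (if a \<noteq> b then 0 else if a \<le> p then 1 else if a \<le> p + q then - 1 else 0)"

definition eta_complex :: "nat \<Rightarrow> nat \<Rightarrow> nat \<Rightarrow> nat \<Rightarrow> complex"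
  where "eta_complex p q a b = (if a \<noteq> b then 0 else if a \<le> p + q then 1 else 0)"

end

(*
  Let R be the ideal generated by the null generators and w = e_1 ... e_n.  The pseudoscalar w
  commutes with every element up to the grade involution (untwisted iff n is odd), so T stabilises
  the line spanned by w in a twisted way iff w (hat T - c T) = 0 for some scalar c.  Adding an
  element of R to a unit gives a unit, and w annihilates R.  Conversely, every two-sided ideal that
  is stable under the grade involution and not contained in R contains a unit; applied to the
  annihilator of w and to the Jacobson radical this shows that both are equal to R.  Combining
  hat T - c T with its image under the grade involution, one gets that the even or the odd part of
  T lies in R, i.e. T = S (1 + x) with S of pure parity and x in R.
*)

theory Submission
  imports Defs
begin

subsection \<open>Units and the Jacobson radical of a ring\<close>

lemma inv_of_unit:
  assumes "x \<in> units_in UNIV"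
  shows "x * inv_of x = 1" "inv_of x * x = 1"
proof -
  from assms obtain y where y: "inverses x y" by (auto simp: units_in_def)
  have "z = y" if "inverses x z" for z
  proof -
    have "z = z * (x * y)" using y by (simp add: inverses_def)
    also have "\<dots> = y" using that by (simp add: inverses_def flip: mult.assoc)
    finally show ?thesis .
  qed
  with y have "inv_of x = y" unfolding inv_of_def by (rule the_equality)
  with y show "x * inv_of x = 1" "inv_of x * x = 1" by (simp_all add: inverses_def)
qed

lemma units_in_iff: "x \<in> units_in A \<longleftrightarrow> x \<in> A \<and> x \<in> units_in UNIV"
  by (auto simp: units_in_def)

lemma unitI: "x * y = 1 \<Longrightarrow> y * x = 1 \<Longrightarrow> x \<in> units_in UNIV"
  by (auto simp: units_in_def inverses_def)

lemma unit_inv_of: "x \<in> units_in UNIV \<Longrightarrow> inv_of x \<in> units_in UNIV"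
  by (rule unitI[of _ x]) (simp_all add: inv_of_unit)

lemma unit_mult_inv_assoc:
  assumes "x \<in> units_in UNIV"
  shows "x * (inv_of x * z) = z" "inv_of x * (x * z) = z"
  using assms by (simp_all add: inv_of_unit flip: mult.assoc)

lemma unit_mult:
  assumes "x \<in> units_in UNIV" "y \<in> units_in UNIV"
  shows "x * y \<in> units_in UNIV"
  by (rule unitI[of _ "inv_of y * inv_of x"])
    (simp_all add: mult.assoc unit_mult_inv_assoc inv_of_unit assms)

section \<open>Maximal left ideals and Krull's theorem\<close>

lemma left_ideal_eq_UNIV_iff: "left_ideal I \<Longrightarrow> I = UNIV \<longleftrightarrow> 1 \<in> I"
  unfolding left_ideal_def by (metis UNIV_I UNIV_eq_I mult_1_right)

lemma maximal_left_idealD: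
  assumes "maximal_left_ideal M"
  shows "left_ideal M" "1 \<notin> M"
proof -
  show l: "left_ideal M" using assms by (simp add: maximal_left_ideal_def)
  show "1 \<notin> M" using assms left_ideal_eq_UNIV_iff[OF l] by (simp add: maximal_left_ideal_def)
qed

lemma maximal_left_idealI:
  assumes "left_ideal M" "1 \<notin> M"
    and gen: "\<And>I x. left_ideal I \<Longrightarrow> M \<subseteq> I \<Longrightarrow> x \<in> I \<Longrightarrow> x \<notin> M \<Longrightarrow> 1 \<in> I"
  shows "maximal_left_ideal M"
  unfolding maximal_left_ideal_def
proof (intro conjI allI impI)
  show "M \<noteq> UNIV" using assms(2) by blast
  fix I assume I: "left_ideal I \<and> M \<subseteq> I"
  then show "I = M \<or> I = UNIV"
    using gen[of I] left_ideal_eq_UNIV_iff[of I] by (metis subset_antisym subsetI)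
qed (rule assms)

text \<open>Krull's theorem by Zorn's lemma: properness is encoded as \<open>1 \<notin> K\<close>, a
  condition that passes to unions of chains.\<close>

lemma left_ideal_in_maximal:
  assumes "left_ideal I" "1 \<notin> I"
  obtains M where "maximal_left_ideal M" "I \<subseteq> M"
proof -
  let ?A = "{K. left_ideal K \<and> I \<subseteq> K \<and> 1 \<notin> K}"
  have "\<exists>M\<in>?A. \<forall>X\<in>?A. M \<subseteq> X \<longrightarrow> X = M"
  proof (rule subset_Zorn_nonempty)
    show "?A \<noteq> {}" using assms by blast
  next
    fix C assume C: "C \<noteq> {}" "subset.chain ?A C"
    then have sub: "\<And>K. K \<in> C \<Longrightarrow> left_ideal K \<and> I \<subseteq> K \<and> 1 \<notin> K"
      and tot: "\<And>K L. K \<in> C \<Longrightarrow> L \<in> C \<Longrightarrow> K \<subseteq> L \<or> L \<subseteq> K"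
      by (auto simp: subset.chain_def)
    have "left_ideal (\<Union>C)"
      unfolding left_ideal_def
    proof (intro conjI ballI allI)
      show "0 \<in> \<Union>C" using C(1) sub unfolding left_ideal_def by blast
    next
      fix x y assume "x \<in> \<Union>C" "y \<in> \<Union>C"
      then obtain K L where "K \<in> C" "L \<in> C" "x \<in> K" "y \<in> L" by blast
      with tot[of K L] obtain N where "N \<in> C" "x \<in> N" "y \<in> N" by blast
      with sub[of N] show "x + y \<in> \<Union>C" unfolding left_ideal_def by blast
    next
      fix a x assume "x \<in> \<Union>C"
      then show "a * x \<in> \<Union>C" using sub unfolding left_ideal_def by blast
    qed
    moreover have "I \<subseteq> \<Union>C" "1 \<notin> \<Union>C" using C(1) sub by blast+
    ultimately show "\<Union>C \<in> ?A" by simp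
  qed
  then obtain M where "M \<in> ?A" and max: "\<forall>X\<in>?A. M \<subseteq> X \<longrightarrow> X = M" ..
  then have M: "left_ideal M" "I \<subseteq> M" "1 \<notin> M" by simp_all
  have "maximal_left_ideal M"
  proof (rule maximal_left_idealI[OF M(1,3)])
    show "1 \<in> X" if "left_ideal X" "M \<subseteq> X" "x \<in> X" "x \<notin> M" for X x
      using bspec[OF max, of X] M(2) that by auto
  qed
  with M(2) show ?thesis using that by blast
qed

lemma maximal_left_ideal_generates:
  assumes "maximal_left_ideal M" "left_ideal I" "M \<subseteq> I" "x \<in> I" "x \<notin> M"
  shows "y \<in> I"
  using assms unfolding maximal_left_ideal_def by blast

section \<open>The Jacobson radical: two-sidedness, invariance under involutions,
  quasi-regularity\<close>

lemma left_ideal_jacobson: "left_ideal jacobson_radical"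
  using maximal_left_idealD(1) unfolding jacobson_radical_def left_ideal_def by blast

text \<open>This is the left ideal \<open>M + I a\<close>. A general \<open>a\<close> serves the
  colon ideals, \<open>a = 1\<close> the sum of two left ideals.\<close>

lemma left_ideal_add_mult_right:
  assumes "left_ideal M" "left_ideal I"
  shows "left_ideal {x + y * a | x y. x \<in> M \<and> y \<in> I}" (is "left_ideal ?S")
  unfolding left_ideal_def
proof (intro conjI ballI allI)
  have "0 = 0 + 0 * a" by simp
  with assms show "0 \<in> ?S" unfolding left_ideal_def by blast
next
  fix u v assume "u \<in> ?S" "v \<in> ?S"
  then obtain x y x' y' where
    u: "u = x + y * a" "x \<in> M" "y \<in> I" and v: "v = x' + y' * a" "x' \<in> M" "y' \<in> I" by blast
  have "u + v = (x + x') + (y + y') * a" using u v by (simp add: algebra_simps)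
  moreover have "x + x' \<in> M" "y + y' \<in> I" using assms u v unfolding left_ideal_def by blast+
  ultimately show "u + v \<in> ?S" by blast
next
  fix b u assume "u \<in> ?S"
  then obtain x y where u: "u = x + y * a" "x \<in> M" "y \<in> I" by blast
  have "b * u = b * x + (b * y) * a" using u by (simp add: algebra_simps)
  moreover have "b * x \<in> M" "b * y \<in> I" using assms u unfolding left_ideal_def by blast+
  ultimately show "b * u \<in> ?S" by blast
qed

text \<open>The colon ideal is the annihilator of the class of \<open>a\<close> in the simple module
  of cosets of \<open>M\<close>. That class generates the module, so the quotient by the annihilator
  is simple as well.\<close>

lemma maximal_left_ideal_colon:
  assumes M: "maximal_left_ideal M" and a: "a \<notin> M"
  shows "maximal_left_ideal {x. x * a \<in> M}"
proof (rule maximal_left_idealI)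
  note lM = maximal_left_idealD(1)[OF M]
  show "left_ideal {x. x * a \<in> M}"
    using lM unfolding left_ideal_def by (auto simp: algebra_simps)
  show "1 \<notin> {x. x * a \<in> M}" using a by simp
  fix I x assume I: "left_ideal I" "{x. x * a \<in> M} \<subseteq> I" "x \<in> I" "x \<notin> {x. x * a \<in> M}"
  let ?S = "{x + y * a | x y. x \<in> M \<and> y \<in> I}"
  have "a \<in> ?S"
  proof (rule maximal_left_ideal_generates[OF M])
    show "left_ideal ?S" by (rule left_ideal_add_mult_right[OF lM I(1)])
    show "M \<subseteq> ?S"
    proof
      fix x assume "x \<in> M"
      moreover have "x = x + 0 * a" "0 \<in> I" using I(1) by (simp_all add: left_ideal_def)
      ultimately show "x \<in> ?S" by blast
    qed
    have "x * a = 0 + x * a" "0 \<in> M" using lM by (simp_all add: left_ideal_def)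
    with I(3) show "x * a \<in> ?S" by blast
    show "x * a \<notin> M" using I(4) by simp
  qed
  then obtain w y where wy: "a = w + y * a" "w \<in> M" "y \<in> I" by blast
  \<comment> \<open>\<open>(1 - y) * a\<close> lies in \<open>M\<close>, so \<open>1 - y\<close>
    belongs to the colon ideal and hence to \<open>I\<close>; adding \<open>y\<close> then gives
    1.\<close>
  have "(1 - y) * a = w" using wy(1) by (simp add: algebra_simps)
  then have "1 - y \<in> I" using I(2) wy(2) by auto
  then have "(1 - y) + y \<in> I" using I(1) wy(3) unfolding left_ideal_def by blast
  then show "1 \<in> I" by simp
qed

text \<open>If \<open>a\<close> is outside \<open>M\<close>, the colon ideal of \<open>a\<close> is
  one of the maximal left ideals whose intersection contains \<open>x\<close>.\<close>

lemma jacobson_mult_right: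
  assumes "x \<in> jacobson_radical"
  shows "x * a \<in> jacobson_radical"
  unfolding jacobson_radical_def
proof clarify
  fix M :: "'a set" assume M: "maximal_left_ideal M"
  show "x * a \<in> M"
  proof (cases "a \<in> M")
    case True
    then show ?thesis using maximal_left_idealD(1)[OF M] by (simp add: left_ideal_def)
  next
    case False
    with assms maximal_left_ideal_colon[OF M] show ?thesis by (auto simp: jacobson_radical_def)
  qed
qed

lemma left_ideal_vimage:
  assumes "left_ideal M" "\<And>x y. h (x + y) = h x + h y" "\<And>x y. h (x * y) = h x * h y"
  shows "left_ideal (h -` M)"
proof -
  have "h 0 = 0" using assms(2)[of 0 0] by simp
  with assms show ?thesis by (simp add: left_ideal_def)
qed

text \<open>Pulling back along an involutive automorphism permutes the maximal left ideals and so
  preserves their intersection.\<close>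

lemma jacobson_involution:
  fixes h :: "'a::ring_1 \<Rightarrow> 'a"
  assumes inv: "\<And>x. h (h x) = x"
    and add: "\<And>x y. h (x + y) = h x + h y" and mult: "\<And>x y. h (x * y) = h x * h y"
    and x: "x \<in> jacobson_radical"
  shows "h x \<in> jacobson_radical"
  unfolding jacobson_radical_def
proof clarify
  \<comment> \<open>\<open>h 1 = h 1 * h (h 1) = h (1 * h 1) = h (h 1) = 1\<close>.\<close>
  have one: "h 1 = 1" by (metis inv mult mult_1_left mult_1_right)
  fix M :: "'a set" assume M: "maximal_left_ideal M"
  note lM = maximal_left_idealD[OF M]
  have "maximal_left_ideal (h -` M)"
  proof (rule maximal_left_idealI)
    show "left_ideal (h -` M)" using left_ideal_vimage[of M h] lM(1) add mult by blast
    show "1 \<notin> h -` M" using lM one by simp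
    fix I x assume I: "left_ideal I" "h -` M \<subseteq> I" "x \<in> I" "x \<notin> h -` M"
    have "1 \<in> h -` I"
    proof (rule maximal_left_ideal_generates[OF M])
      show "left_ideal (h -` I)" using left_ideal_vimage[of I h] I(1) add mult by blast
      show "M \<subseteq> h -` I" using I(2) inv by auto
      show "h x \<in> h -` I" "h x \<notin> M" using I inv by auto
    qed
    then show "1 \<in> I" using one by simp
  qed
  with x show "h x \<in> M" by (auto simp: jacobson_radical_def)
qed

text \<open>Since \<open>0 \<noteq> 1\<close> in \<open>ring_1\<close>, the ideal \<open>{0}\<close>
  is proper and some maximal left ideal exists, so the intersection is not over an empty
  family.\<close>

lemma one_notin_jacobson: "(1::'a::ring_1) \<notin> jacobson_radical"
proof -
  have "left_ideal {0::'a}" by (simp add: left_ideal_def)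
  then obtain M :: "'a set" where "maximal_left_ideal M"
    using left_ideal_in_maximal[of "{0}"] by auto
  then have "maximal_left_ideal M \<and> 1 \<notin> M" using maximal_left_idealD(2) by blast
  then show ?thesis unfolding jacobson_radical_def by blast
qed

lemma unit_notin_jacobson:
  assumes "x \<in> units_in UNIV"
  shows "x \<notin> jacobson_radical"
proof
  assume "x \<in> jacobson_radical"
  then have "inv_of x * x \<in> jacobson_radical" using left_ideal_jacobson unfolding left_ideal_def by blast
  then show False by (simp add: one_notin_jacobson inv_of_unit(2)[OF assms])
qed

text \<open>If a maximal \<open>M\<close> missed an element of \<open>I\<close>, then
  \<open>M + I\<close> would be the whole ring; writing \<open>1 = w + y\<close> puts the unit
  \<open>w = 1 - y\<close> into \<open>M\<close>.\<close>

lemma left_ideal_subset_jacobson: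
  fixes I :: "'a::ring_1 set"
  assumes I: "left_ideal I" and u: "\<And>x. x \<in> I \<Longrightarrow> 1 - x \<in> units_in UNIV"
  shows "I \<subseteq> jacobson_radical"
  unfolding jacobson_radical_def
proof clarify
  fix x and M :: "'a set" assume x: "x \<in> I" and M: "maximal_left_ideal M"
  note lM = maximal_left_idealD[OF M]
  \<comment> \<open>The factor \<open>* 1\<close> gives \<open>M + I\<close> the shape of
    \<open>left_ideal_add_mult_right\<close>.\<close>
  let ?S = "{x + y * 1 | x y. x \<in> M \<and> y \<in> I}"
  show "x \<in> M"
  proof (rule ccontr)
    assume xM: "x \<notin> M"
    have "1 \<in> ?S"
    proof (rule maximal_left_ideal_generates[OF M])
      show "left_ideal ?S" by (rule left_ideal_add_mult_right[OF lM(1) I])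
      show "M \<subseteq> ?S"
      proof
        fix y assume "y \<in> M"
        moreover have "y = y + 0 * 1" "0 \<in> I" using I by (simp_all add: left_ideal_def)
        ultimately show "y \<in> ?S" by blast
      qed
      have "x = 0 + x * 1" "0 \<in> M" using lM by (simp_all add: left_ideal_def)
      with x show "x \<in> ?S" by blast
    qed (rule xM)
    then obtain w y where wy: "1 = w + y" "w \<in> M" "y \<in> I" by auto
    then have "w = 1 - y" by (simp add: algebra_simps)
    with u[OF wy(3)] have "inv_of w * w = 1" by (simp add: inv_of_unit)
    moreover have "inv_of w * w \<in> M" using lM wy by (simp add: left_ideal_def)
    ultimately show False using lM by simp
  qed
qed

subsection \<open>Geometric algebras with a diagonal form\<close>

text \<open>Common frame for the real and the complex case, with \<open>m\<close> standing for
  \<open>p + q\<close>. Of the form it records diagonality and which diagonal entries vanish, of the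
  field that 2 is invertible.\<close>

locale diagonal_geometric_algebra = geometric_algebra scale n \<eta> e
  for scale :: "'f::field \<Rightarrow> 'a::ring_1 \<Rightarrow> 'a" (infixr \<open>*s\<close> 75) and n \<eta> e +
  fixes m :: nat
  assumes m_le_n: "m \<le> n"
    and two_neq_0: "(2::'f) \<noteq> 0"
    and off_diagonal: "a \<in> {1..n} \<Longrightarrow> b \<in> {1..n} \<Longrightarrow> a \<noteq> b \<Longrightarrow> \<eta> a b = 0"
    and nonnull: "a \<in> {1..m} \<Longrightarrow> \<eta> a a \<noteq> 0"
    and null: "a \<in> {m<..n} \<Longrightarrow> \<eta> a a = 0"
begin

interpretation endo: vector_space_pair scale scale
  by unfold_locales

declare scale_mult_left [simp] scale_mult_right [simp]

lemma scale_two: "2 *s x = x + x"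
  using scale_left_distrib[of 1 1 x] by simp

lemma half_double: "(1 / 2) *s (x + x) = x"
  using two_neq_0 by (simp flip: scale_two)

lemma generator_square: "a \<in> {1..n} \<Longrightarrow> e a * e a = \<eta> a a *s 1"
  using relations[of a a] half_double[of "e a * e a"] two_neq_0 by simp

lemma generator_anticommute:
  "a \<in> {1..n} \<Longrightarrow> b \<in> {1..n} \<Longrightarrow> a \<noteq> b \<Longrightarrow> e a * e b = - (e b * e a)"
  using relations[of a b] off_diagonal[of a b] by (simp add: eq_neg_iff_add_eq_0)

text \<open>The axiom \<open>generated\<close> as an induction rule, for properties that are stable
  under linear combinations and products.\<close>

lemma algebra_induct [case_names subspace one mult generator]:
  assumes "subspace {x. P x}" "P 1" "\<And>x y. P x \<Longrightarrow> P y \<Longrightarrow> P (x * y)"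
    "\<And>a. a \<in> {1..n} \<Longrightarrow> P (e a)"
  shows "P x"
  using generated[of "{x. P x}"] assms by blast

section \<open>Ordered products of generators form a basis\<close>

abbreviation word :: "nat list \<Rightarrow> 'a"
  where "word xs \<equiv> prod_list (map e xs)"

lemma basis_elem_set: "sorted_wrt (<) xs \<Longrightarrow> basis_elem (set xs) = word xs"
  by (simp add: basis_elem_def sorted_list_of_set.idem_if_sorted_distinct strict_sorted_iff)

lemma basis_elem_Min:
  assumes "k \<in> A" "A \<subseteq> {k..n}"
  shows "basis_elem A = e k * basis_elem (A - {k})"
proof -
  have "finite A" using assms(2) finite_subset by blast
  moreover have "Min A = k" using assms \<open>finite A\<close> by (intro Min_eqI) auto
  moreover have "A \<noteq> {}" using assms by blast
  ultimately have "sorted_list_of_set A = k # sorted_list_of_set (A - {k})"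
    using sorted_list_of_set_nonempty[of A] by simp
  then show ?thesis by (simp add: basis_elem_def)
qed

text \<open>Insertion sort: each smaller index that \<open>a\<close> passes costs a sign, and
  meeting \<open>a\<close> itself contracts to the factor \<open>\<eta> a a\<close>, which is 0 for
  a null generator.\<close>

lemma generator_mult_word:
  assumes "sorted_wrt (<) xs" "set xs \<subseteq> {1..n}" "a \<in> {1..n}"
  shows "\<exists>c ys. sorted_wrt (<) ys \<and>
    set ys = (if a \<in> set xs then set xs - {a} else insert a (set xs)) \<and> e a * word xs = c *s word ys"
  using assms
proof (induction xs)
  case Nil
  show ?case by (intro exI[of _ 1] exI[of _ "[a]"]) simp
next
  case (Cons x xs)
  consider "a < x" | "a = x" | "x < a" by linarith
  then show ?case
  proof cases
    case 1
    then have "a \<notin> set (x # xs)" using Cons.prems(1) by auto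
    with 1 Cons.prems show ?thesis
      by (intro exI[of _ 1] exI[of _ "a # x # xs"]) auto
  next
    case 2
    then have "e a * word (x # xs) = \<eta> a a *s word xs"
      using generator_square[of a] Cons.prems(3) by (simp flip: mult.assoc)
    moreover have "set xs = set (x # xs) - {a}" using 2 Cons.prems(1) by auto
    ultimately show ?thesis
      using 2 Cons.prems(1) by (intro exI[of _ "\<eta> a a"] exI[of _ xs]) simp
  next
    case 3
    from Cons obtain c ys where ys: "sorted_wrt (<) ys"
      "set ys = (if a \<in> set xs then set xs - {a} else insert a (set xs))"
      "e a * word xs = c *s word ys"
      by auto
    have "e a * word (x # xs) = e a * e x * word xs" by (simp add: mult.assoc)
    also have "\<dots> = - (e x * (e a * word xs))"
      using generator_anticommute[of a x] 3 Cons.prems by (simp add: mult.assoc)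
    also have "\<dots> = (- c) *s word (x # ys)" by (simp add: ys(3))
    finally have "e a * word (x # xs) = (- c) *s word (x # ys)" .
    moreover have "sorted_wrt (<) (x # ys)"
      using 3 ys(1,2) Cons.prems(1) by (auto split: if_splits)
    ultimately show ?thesis
      using 3 ys(2) Cons.prems(1) by (intro exI[of _ "- c"] exI[of _ "x # ys"]) auto
  qed
qed

text \<open>One index is added or removed, so the parity of the degree flips. This serves the
  spanning argument and the sign rule of the grade involution.\<close>

lemma generator_mult_basis_elem:
  assumes A: "A \<subseteq> {1..n}" and a: "a \<in> {1..n}"
  obtains c B where "B \<subseteq> {1..n}" "even (card B) \<longleftrightarrow> odd (card A)" "e a * basis_elem A = c *s basis_elem B"
proof -
  have fin: "finite A" using A finite_subset by blast
  then have s: "sorted_wrt (<) (sorted_list_of_set A)" "set (sorted_list_of_set A) = A" by simp_all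
  have "\<exists>c ys. sorted_wrt (<) ys \<and> set ys = (if a \<in> A then A - {a} else insert a A) \<and>
      e a * basis_elem A = c *s word ys"
    using generator_mult_word[OF s(1) _ a] A unfolding basis_elem_def s(2) .
  then obtain c ys where ys: "sorted_wrt (<) ys"
      "set ys = (if a \<in> A then A - {a} else insert a A)" "e a * basis_elem A = c *s word ys"
    by (elim exE conjE) (rule that)
  have "even (card (set ys)) \<longleftrightarrow> odd (card A)"
  proof (cases "a \<in> A")
    case True
    then have "card A = Suc (card (set ys))" using ys(2) card.remove[OF fin True] by simp
    then show ?thesis by simp
  next
    case False
    then show ?thesis using ys(2) fin by simp
  qed
  moreover have "set ys \<subseteq> {1..n}" using ys(2) A a by (auto split: if_splits)
  moreover have "e a * basis_elem A = c *s basis_elem (set ys)"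
    using ys(3) basis_elem_set[OF ys(1)] by simp
  ultimately show thesis using that[of "set ys" c] by blast
qed

text \<open>The span absorbs left multiplication by generators, hence by every element, and it
  contains 1.\<close>

lemma span_basis_elems: "span (basis_elem ` Pow {1..n}) = UNIV"
proof -
  let ?S = "span (basis_elem ` Pow {1..n})"
  have "\<forall>y\<in>?S. x * y \<in> ?S" for x
  proof (induction x rule: algebra_induct)
    case subspace
    show ?case
      by (auto simp: subspace_def span_zero span_add span_scale distrib_right)
  next
    case (mult x y)
    then show ?case by (simp add: mult.assoc)
  next
    case (generator a)
    show ?case
    proof
      fix y assume "y \<in> ?S"
      then show "e a * y \<in> ?S"
      proof (induction rule: span_induct)
        case base
        show ?case
          by (auto simp: subspace_def span_zero span_add span_scale distrib_left)
      next
        case (step y)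
        then obtain A where A: "A \<subseteq> {1..n}" "y = basis_elem A" by blast
        obtain c B where "B \<subseteq> {1..n}" "e a * basis_elem A = c *s basis_elem B"
          by (rule generator_mult_basis_elem[OF A(1) generator])
        then show ?case using A(2) by (simp add: span_scale span_base)
      qed
    qed
  qed simp
  moreover have "1 \<in> ?S"
    by (rule span_base) (auto simp: basis_elem_def intro!: image_eqI[of _ _ "{}"])
  ultimately show ?thesis by (metis UNIV_eq_I mult_1_right)
qed

text \<open>Counting: at most \<open>2 ^ n\<close> vectors span a space of dimension
  \<open>2 ^ n\<close>, so they are distinct and independent.\<close>

lemma basis_elems_basis:
  "independent (basis_elem ` Pow {1..n})" "inj_on basis_elem (Pow {1..n})"
proof -
  let ?B = "basis_elem ` Pow {1..n}"
  have card_le: "card ?B \<le> 2 ^ n"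
    using card_image_le[of "Pow {1..n}" basis_elem] by (simp add: card_Pow)
  obtain C where C: "C \<subseteq> ?B" "independent C" "?B \<subseteq> span C"
    by (rule maximal_independent_subset)
  have "span C = UNIV"
    using span_minimal[OF C(3) subspace_span] span_basis_elems by blast
  then have "card C = 2 ^ n" using dim_eq_card[of C UNIV] C(2) dimension by simp
  with C(1) card_le have "C = ?B" by (intro card_seteq) auto
  with \<open>card C = 2 ^ n\<close> C(2) show "independent ?B" "inj_on basis_elem (Pow {1..n})"
    by (auto intro!: eq_card_imp_inj_on simp: card_Pow)
qed

section \<open>The grade involution\<close>

lemma is_grade_involution_exists: "\<exists>h. is_grade_involution h"
proof -
  \<comment> \<open>The map is prescribed on the basis by the sign of the degree;
    \<open>inv_into\<close> recovers the index set of a basis element, which is legitimate by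
    injectivity.\<close>
  let ?f = "\<lambda>x. (- 1) ^ card (inv_into (Pow {1..n}) basis_elem x) *s x"
  obtain h where lin: "Vector_Spaces.linear scale scale h"
    and "\<forall>x\<in>basis_elem ` Pow {1..n}. h x = ?f x"
    using endo.linear_independent_extend[OF basis_elems_basis(1), of ?f] by blast
  then have h: "h (basis_elem A) = (- 1) ^ card A *s basis_elem A" if "A \<subseteq> {1..n}" for A
    using that basis_elems_basis(2) by simp
  note lins = endo.linear_0[OF lin] endo.linear_add[OF lin] endo.linear_scale[OF lin]
    endo.linear_neg[OF lin]
  have h1: "h 1 = 1" using h[of "{}"] by (simp add: basis_elem_def)
  \<comment> \<open>Left multiplication by a generator flips parity, hence the sign.
    Multiplicativity then follows by induction on the left factor.\<close>
  have gen: "h (e a * y) = - (e a * h y)" if a: "a \<in> {1..n}" for a y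
  proof -
    have "y \<in> span (basis_elem ` Pow {1..n})" by (simp only: span_basis_elems UNIV_I)
    then show ?thesis
    proof (induction rule: span_induct)
      case base
      show ?case by (auto simp: subspace_def lins distrib_left)
    next
      case (step y)
      then obtain A where A: "A \<subseteq> {1..n}" "y = basis_elem A" by blast
      obtain c B where B: "B \<subseteq> {1..n}" "even (card B) \<longleftrightarrow> odd (card A)"
        "e a * basis_elem A = c *s basis_elem B"
        by (rule generator_mult_basis_elem[OF A(1) a])
      then show ?case using A by (cases "even (card A)") (simp_all add: h lins)
    qed
  qed
  have mult: "\<forall>y. h (x * y) = h x * h y" for x
  proof (induction x rule: algebra_induct)
    case subspace
    show ?case by (auto simp: subspace_def lins distrib_right)
  next
    case (generator a)
    then show ?case using gen[of a 1] h1 by (simp add: gen)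
  qed (simp_all add: h1 mult.assoc)
  have inv: "h (h x) = x" for x
  proof (induction x rule: algebra_induct)
    case subspace
    show ?case by (auto simp: subspace_def lins)
  next
    case (generator a)
    then show ?case using gen[of a 1] h1 by (simp add: lins)
  qed (simp_all add: h1 mult)
  have "h (e a) = - e a" if "a \<in> {1..n}" for a using gen[OF that, of 1] h1 by simp
  moreover have "bij h" using inv by (intro o_bij[of h h]) auto
  ultimately show ?thesis using lin h1 mult by (auto simp: is_grade_involution_def)
qed

lemma is_grade_involution_unique:
  assumes "is_grade_involution g" "is_grade_involution h"
  shows "g = h"
proof
  have lin: "Vector_Spaces.linear scale scale g" "Vector_Spaces.linear scale scale h"
    and one: "g 1 = 1" "h 1 = 1"
    and mult: "\<And>x y. g (x * y) = g x * g y" "\<And>x y. h (x * y) = h x * h y"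
    and gen: "\<And>a. a \<in> {1..n} \<Longrightarrow> g (e a) = - e a" "\<And>a. a \<in> {1..n} \<Longrightarrow> h (e a) = - e a"
    using assms by (simp_all add: is_grade_involution_def)
  show "g x = h x" for x
  proof (induction x rule: algebra_induct)
    case subspace
    show ?case
      by (simp add: subspace_def lin[THEN endo.linear_0] lin[THEN endo.linear_add]
          lin[THEN endo.linear_scale])
  qed (simp_all add: one mult gen)
qed

lemma is_grade_involution_hat: "is_grade_involution hat"
proof -
  obtain h where h: "is_grade_involution h" using is_grade_involution_exists ..
  show ?thesis
    unfolding hat_def
    by (rule theI[of is_grade_involution, OF h is_grade_involution_unique[OF _ h]])
qed

lemma linear_hat: "Vector_Spaces.linear scale scale hat"
  using is_grade_involution_hat by (simp add: is_grade_involution_def)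

lemma hat_simps [simp]:
  "hat 0 = 0" "hat 1 = 1" "hat (x + y) = hat x + hat y" "hat (x - y) = hat x - hat y"
  "hat (- x) = - hat x" "hat (c *s x) = c *s hat x" "hat (x * y) = hat x * hat y"
  using is_grade_involution_hat
  by (simp_all add: is_grade_involution_def endo.linear_0 endo.linear_add endo.linear_scale
      endo.linear_neg endo.linear_diff)

lemma hat_generator [simp]: "a \<in> {1..n} \<Longrightarrow> hat (e a) = - e a"
  using is_grade_involution_hat by (simp add: is_grade_involution_def)

lemma hat_hat [simp]: "hat (hat x) = x"
  by (induction x rule: algebra_induct) (auto simp: subspace_def)

lemma hat_word: "set xs \<subseteq> {1..n} \<Longrightarrow> hat (word xs) = (- 1) ^ length xs *s word xs"
  by (induction xs) simp_all

text \<open>Each swap of \<open>e a\<close> with a different generator costs a sign, and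
  \<open>hat\<close> supplies exactly these signs.\<close>

lemma generator_mult_hat_word:
  assumes "a \<in> {1..n}" "set xs \<subseteq> {1..n}" "a \<notin> set xs"
  shows "e a * hat (word xs) = word xs * e a"
  using assms(2,3)
proof (induction xs)
  case (Cons x xs)
  have "e a * hat (word (x # xs)) = - (e a * e x) * hat (word xs)"
    using Cons.prems by (simp add: mult.assoc)
  also have "\<dots> = e x * (e a * hat (word xs))"
    using generator_anticommute[of a x] assms(1) Cons.prems by (simp add: mult.assoc)
  also have "\<dots> = word (x # xs) * e a" using Cons by (simp add: mult.assoc)
  finally show ?case .
qed simp

section \<open>Null generators and the ideal they generate\<close>

lemma null_generator_commute:
  assumes z: "z \<in> {m<..n}"
  shows "e z * x = hat x * e z"
proof (induction x rule: algebra_induct)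
  case subspace
  show ?case by (auto simp: subspace_def distrib_left distrib_right)
next
  case (mult x y)
  then show ?case by (metis hat_simps(7) mult.assoc)
next
  case (generator a)
  show ?case
  proof (cases "a = z")
    \<comment> \<open>Here both sides are 0, because \<open>e z\<close> squares to 0. This is what
      sets null generators apart from the others.\<close>
    case True
    then show ?thesis using generator generator_square[of z] null[OF z] by simp
  next
    case False
    then show ?thesis using generator generator_anticommute[of z a] z by auto
  qed
qed simp

lemma null_generator_sandwich: "z \<in> {m<..n} \<Longrightarrow> e z * x * e z = 0"
  using null_generator_commute[of z x] generator_square[of z] null[of z] by (simp add: mult.assoc)

text \<open>Written as the right ideal generated by the null generators; twisted commutation makes
  it two-sided. For \<open>m = n\<close> the sum is empty and the ideal is
  \<open>{0}\<close>.\<close>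

definition null_ideal :: "'a set"
  where "null_ideal = range (\<lambda>u. \<Sum>z\<in>{m<..n}. e z * u z)"

lemma null_idealI: "x = (\<Sum>z\<in>{m<..n}. e z * u z) \<Longrightarrow> x \<in> null_ideal"
  by (auto simp: null_ideal_def)

text \<open>As 2 is invertible, stability under \<open>hat\<close> amounts to containing the even
  and odd parts of all elements.\<close>

definition graded_ideal :: "'a set \<Rightarrow> bool"
  where "graded_ideal I \<longleftrightarrow> 0 \<in> I \<and> (\<forall>x\<in>I. \<forall>y\<in>I. x + y \<in> I) \<and>
    (\<forall>a. \<forall>x\<in>I. a * x \<in> I \<and> x * a \<in> I) \<and> (\<forall>x\<in>I. hat x \<in> I)"

lemma graded_idealD:
  assumes "graded_ideal I"
  shows "0 \<in> I" "x \<in> I \<Longrightarrow> y \<in> I \<Longrightarrow> x + y \<in> I" "x \<in> I \<Longrightarrow> a * x \<in> I" "x \<in> I \<Longrightarrow> x * a \<in> I"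
    "x \<in> I \<Longrightarrow> hat x \<in> I" "x \<in> I \<Longrightarrow> c *s x \<in> I" "x \<in> I \<Longrightarrow> y \<in> I \<Longrightarrow> x - y \<in> I"
    "subspace I"
proof -
  show *: "0 \<in> I" "\<And>x y. x \<in> I \<Longrightarrow> y \<in> I \<Longrightarrow> x + y \<in> I" "\<And>x a. x \<in> I \<Longrightarrow> a * x \<in> I"
    "\<And>x. x \<in> I \<Longrightarrow> x * a \<in> I" "\<And>x. x \<in> I \<Longrightarrow> hat x \<in> I"
    using assms unfolding graded_ideal_def by blast+
  show scale: "\<And>x c. x \<in> I \<Longrightarrow> c *s x \<in> I" using *(3)[of _ "_ *s 1"] by simp
  show "subspace I" using * scale by (simp add: subspace_def)
  then show "x \<in> I \<Longrightarrow> y \<in> I \<Longrightarrow> x - y \<in> I" by (rule subspace_diff)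
qed

lemma graded_ideal_null: "graded_ideal null_ideal"
  unfolding graded_ideal_def
proof (intro conjI ballI allI)
  show "0 \<in> null_ideal" by (rule null_idealI[of _ "\<lambda>_. 0"]) simp
next
  fix x y assume "x \<in> null_ideal" "y \<in> null_ideal"
  then obtain u v where "x = (\<Sum>z\<in>{m<..n}. e z * u z)" "y = (\<Sum>z\<in>{m<..n}. e z * v z)"
    by (auto simp: null_ideal_def)
  then have "x + y = (\<Sum>z\<in>{m<..n}. e z * (u z + v z))" by (simp add: distrib_left sum.distrib)
  then show "x + y \<in> null_ideal" by (rule null_idealI)
next
  fix a x assume "x \<in> null_ideal"
  then obtain u where x: "x = (\<Sum>z\<in>{m<..n}. e z * u z)" by (auto simp: null_ideal_def)
  \<comment> \<open>Moving \<open>a\<close> past each \<open>e z\<close> turns left multiples into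
    right multiples.\<close>
  have "a * e z = e z * hat a" if "z \<in> {m<..n}" for z
    using null_generator_commute[OF that, of "hat a"] by simp
  then have "a * x = (\<Sum>z\<in>{m<..n}. e z * (hat a * u z))"
    unfolding x sum_distrib_left by (intro sum.cong) (simp_all flip: mult.assoc)
  then show "a * x \<in> null_ideal" by (rule null_idealI)
  have "x * a = (\<Sum>z\<in>{m<..n}. e z * (u z * a))"
    by (simp add: x sum_distrib_right mult.assoc)
  then show "x * a \<in> null_ideal" by (rule null_idealI)
next
  fix x assume "x \<in> null_ideal"
  then obtain u where x: "x = (\<Sum>z\<in>{m<..n}. e z * u z)" by (auto simp: null_ideal_def)
  have "hat x = (\<Sum>z\<in>{m<..n}. e z * (- hat (u z)))"
    unfolding x endo.linear_sum[OF linear_hat] by (intro sum.cong) auto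
  then show "hat x \<in> null_ideal" by (rule null_idealI)
qed

lemma null_generator_mult:
  assumes "z \<in> {m<..n}"
  shows "e z * x \<in> null_ideal"
proof -
  have "e z * x = (\<Sum>y\<in>{m<..n}. if y = z then e y * x else 0)" using assms by simp
  also have "\<dots> = (\<Sum>y\<in>{m<..n}. e y * (if y = z then x else 0))" by (intro sum.cong) auto
  finally show ?thesis by (rule null_idealI[of _ "\<lambda>y. if y = z then x else 0"])
qed

text \<open>The sum factors as \<open>T * (1 + e z * v)\<close>, where \<open>e z * v\<close> has
  square 0 and so \<open>1 - e z * v\<close> inverts the second factor.\<close>

lemma unit_add_null_generator_mult:
  assumes T: "T \<in> units_in UNIV" and z: "z \<in> {m<..n}"
  shows "T + e z * x \<in> units_in UNIV"
proof -
  \<comment> \<open>The \<open>hat\<close> compensates for moving \<open>inv_of T\<close> past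
    \<open>e z\<close>, so that \<open>T * (e z * v) = e z * x\<close>.\<close>
  define v where "v = hat (inv_of T) * x"
  have sq: "e z * v * (e z * v) = 0"
    using null_generator_sandwich[OF z, of v] by (simp flip: mult.assoc)
  have "1 + e z * v \<in> units_in UNIV"
    by (rule unitI[of _ "1 - e z * v"]) (simp_all add: algebra_simps sq[unfolded mult.assoc])
  moreover have "T * (e z * v) = e z * x"
  proof -
    have "e z * v = inv_of T * (e z * x)"
      using null_generator_commute[OF z, of "hat (inv_of T)"] by (simp add: v_def flip: mult.assoc)
    then show ?thesis using T by (simp add: unit_mult_inv_assoc)
  qed
  then have "T * (1 + e z * v) = T + e z * x" by (simp add: distrib_left)
  ultimately show ?thesis using unit_mult[OF T] by metis
qed

text \<open>The summands \<open>e z * u z\<close> are added one at a time, and each addition keeps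
  the partial sum a unit.\<close>

lemma unit_add_null:
  assumes "T \<in> units_in UNIV" "x \<in> null_ideal"
  shows "T + x \<in> units_in UNIV"
proof -
  have "T + (\<Sum>z\<in>Z. e z * u z) \<in> units_in UNIV" if "finite Z" "Z \<subseteq> {m<..n}" for Z u
    using that
  proof (induction Z)
    case empty
    show ?case using assms(1) by simp
  next
    case (insert z Z)
    have "T + (\<Sum>z\<in>Z. e z * u z) + e z * u z \<in> units_in UNIV"
      by (rule unit_add_null_generator_mult) (use insert in auto)
    then show ?case using insert.hyps by (simp add: algebra_simps)
  qed
  with assms(2) show ?thesis by (auto simp: null_ideal_def)
qed

lemma unit_diff_null:
  assumes "T \<in> units_in UNIV" "x \<in> null_ideal"
  shows "T - x \<in> units_in UNIV"
  using unit_add_null[OF assms(1) graded_idealD(3)[OF graded_ideal_null assms(2), of "- 1"]] by simp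

section \<open>Units in graded ideals and the determination of the radical\<close>

lemma scale_one_unit: "c \<noteq> 0 \<Longrightarrow> c *s 1 \<in> units_in UNIV"
  by (rule unitI[of _ "(1 / c) *s 1"]) simp_all

text \<open>For \<open>k \<ge> 1\<close> these are the elements free of the generators before
  \<open>e k\<close>. In \<open>tail (Suc m)\<close> only null generators remain.\<close>

definition tail :: "nat \<Rightarrow> 'a set"
  where "tail k = span (basis_elem ` Pow {k..n})"

lemma tail_one: "tail (Suc 0) = UNIV"
  using span_basis_elems by (simp add: tail_def)

text \<open>A basis element over \<open>{k..n}\<close> either omits \<open>k\<close> or,
  \<open>k\<close> being its smallest index, has \<open>e k\<close> as its first factor.\<close>

lemma tail_Suc_decomp:
  assumes "x \<in> tail k"
  obtains u v where "u \<in> tail (Suc k)" "v \<in> tail (Suc k)" "x = u + e k * v"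
proof -
  let ?S = "{u + e k * v | u v. u \<in> tail (Suc k) \<and> v \<in> tail (Suc k)}"
  have zero: "0 \<in> tail (Suc k)" by (simp add: tail_def span_zero)
  have "tail k \<subseteq> ?S"
    unfolding tail_def[of k]
  proof (rule span_minimal)
    show "basis_elem ` Pow {k..n} \<subseteq> ?S"
    proof clarify
      fix A assume A: "A \<subseteq> {k..n}"
      have *: "basis_elem (A - {k}) \<in> tail (Suc k)"
        unfolding tail_def using A
        by (intro span_base imageI) (auto simp: Suc_le_eq order.strict_iff_order)
      show "\<exists>u v. basis_elem A = u + e k * v \<and> u \<in> tail (Suc k) \<and> v \<in> tail (Suc k)"
      proof (cases "k \<in> A")
        case True
        then have "basis_elem A = 0 + e k * basis_elem (A - {k})"
          using basis_elem_Min[OF True A] by simp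
        with * zero show ?thesis by blast
      next
        case False
        then have "basis_elem A = basis_elem (A - {k}) + e k * 0" by simp
        with * zero show ?thesis by blast
      qed
    qed
    show "subspace ?S"
      unfolding subspace_def
    proof (intro conjI ballI allI)
      have "0 = 0 + e k * 0" by simp
      with zero show "0 \<in> ?S" by blast
    next
      fix x y assume "x \<in> ?S" "y \<in> ?S"
      then obtain u v u' v' where x: "x = u + e k * v" "u \<in> tail (Suc k)" "v \<in> tail (Suc k)"
        and y: "y = u' + e k * v'" "u' \<in> tail (Suc k)" "v' \<in> tail (Suc k)" by blast
      have "x + y = (u + u') + e k * (v + v')" using x y by (simp add: algebra_simps)
      moreover have "u + u' \<in> tail (Suc k)" "v + v' \<in> tail (Suc k)"
        using x y unfolding tail_def by (simp_all add: span_add)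
      ultimately show "x + y \<in> ?S" by blast
    next
      fix c x assume "x \<in> ?S"
      then obtain u v where x: "x = u + e k * v" "u \<in> tail (Suc k)" "v \<in> tail (Suc k)" by blast
      have "c *s x = c *s u + e k * (c *s v)" using x by (simp add: scale_right_distrib)
      moreover have "c *s u \<in> tail (Suc k)" "c *s v \<in> tail (Suc k)"
        using x unfolding tail_def by (simp_all add: span_scale)
      ultimately show "c *s x \<in> ?S" by blast
    qed
  qed
  with assms that show thesis by blast
qed

text \<open>A nonempty product of null generators lies in \<open>null_ideal\<close>, so only the
  empty product contributes the scalar.\<close>

lemma tail_null_decomp:
  assumes "x \<in> tail (Suc m)"
  obtains c where "x - c *s 1 \<in> null_ideal"
proof -
  note R = graded_idealD[OF graded_ideal_null]
  have "\<exists>c. x - c *s 1 \<in> null_ideal"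
    using assms unfolding tail_def
  proof (induction rule: span_induct)
    case base
    show ?case
      unfolding subspace_def mem_Collect_eq
    proof (intro conjI ballI allI)
      show "\<exists>c. 0 - c *s 1 \<in> null_ideal" using R(1) by (intro exI[of _ 0]) simp
    next
      fix x y assume "x \<in> {x. \<exists>c. x - c *s 1 \<in> null_ideal}" "y \<in> {x. \<exists>c. x - c *s 1 \<in> null_ideal}"
      then obtain c d where "x - c *s 1 \<in> null_ideal" "y - d *s 1 \<in> null_ideal" by blast
      from R(2)[OF this] have "(x + y) - (c + d) *s 1 \<in> null_ideal"
        by (simp add: scale_left_distrib algebra_simps)
      then show "\<exists>c. x + y - c *s 1 \<in> null_ideal" ..
    next
      fix a x assume "x \<in> {x. \<exists>c. x - c *s 1 \<in> null_ideal}"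
      then obtain c where "x - c *s 1 \<in> null_ideal" by blast
      from R(6)[OF this, of a] have "a *s x - (a * c) *s 1 \<in> null_ideal"
        by (simp add: scale_right_diff_distrib)
      then show "\<exists>c. a *s x - c *s 1 \<in> null_ideal" ..
    qed
  next
    case (step x)
    then obtain A where A: "A \<subseteq> {Suc m..n}" "x = basis_elem A" by blast
    show ?case
    proof (cases "A = {}")
      case True
      then show ?thesis using A(2) R(1) by (intro exI[of _ 1]) (simp add: basis_elem_def)
    next
      case False
      have fin: "finite A" using A(1) finite_subset by blast
      with False A(1) have "Min A \<in> A" "A \<subseteq> {Min A..n}" by auto
      then have "x = e (Min A) * basis_elem (A - {Min A})" using A(2) basis_elem_Min by blast
      moreover have "Min A \<in> {m<..n}" using \<open>Min A \<in> A\<close> A(1) by auto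
      ultimately have "x \<in> null_ideal" using null_generator_mult by blast
      then show ?thesis by (intro exI[of _ 0]) simp
    qed
  qed
  with that show thesis by blast
qed

lemma generator_mult_hat_tail:
  assumes a: "a \<in> {1..n}" and "x \<in> tail (Suc a)"
  shows "e a * hat x = x * e a"
  using assms(2) unfolding tail_def
proof (induction rule: span_induct)
  case base
  show ?case by (auto simp: subspace_def distrib_left distrib_right)
next
  case (step x)
  then obtain A where A: "A \<subseteq> {Suc a..n}" "x = basis_elem A" by blast
  then have "finite A" using finite_subset by blast
  with A show ?case
    unfolding basis_elem_def A(2) by (intro generator_mult_hat_word[OF a]) auto
qed

text \<open>
  For a non-null \<open>e k\<close>, the map \<open>x \<mapsto> (x + e k * hat x * (e k)\<^sup>-\<^sup>1) / 2\<close> preserves \<open>I\<close> and sends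
  \<open>u + e k * v\<close>, with \<open>u\<close> and \<open>v\<close> free of \<open>e 1, \<dots>, e k\<close>, to \<open>u\<close>. So the non-null generators can be
  stripped off one after the other; the null generators come last, and what remains is a scalar
  modulo \<open>null_ideal\<close>.
\<close>

lemma graded_ideal_has_unit:
  assumes I: "graded_ideal I" and notsub: "\<not> I \<subseteq> null_ideal"
  obtains x where "x \<in> I" "x \<in> units_in UNIV"
proof -
  note R = graded_idealD[OF graded_ideal_null]
  note I = graded_idealD[OF I]
  \<comment> \<open>Downward induction on \<open>k\<close>: at \<open>Suc m\<close> the element
    \<open>x\<close> is itself a unit, and \<open>tail 1\<close> is the whole algebra.\<close>
  have "\<forall>x\<in>I. x \<in> tail k \<longrightarrow> x \<notin> null_ideal \<longrightarrow> (\<exists>y\<in>I. y \<in> units_in UNIV)"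
    if "1 \<le> k" "k \<le> Suc m" for k
    using that(2,1)
  proof (induction k rule: inc_induct)
    case base
    show ?case
    proof (intro ballI impI)
      fix x assume x: "x \<in> I" "x \<in> tail (Suc m)" "x \<notin> null_ideal"
      obtain c where c: "x - c *s 1 \<in> null_ideal" using x(2) by (rule tail_null_decomp)
      with x(3) have "c \<noteq> 0" by auto
      then have "c *s 1 + (x - c *s 1) \<in> units_in UNIV"
        by (intro unit_add_null scale_one_unit c)
      with x(1) show "\<exists>y\<in>I. y \<in> units_in UNIV" by auto
    qed
  next
    case (step k)
    then have k: "k \<in> {1..n}" "k \<in> {1..m}" using m_le_n by auto
    show ?case
    proof (intro ballI impI)
      fix x assume x: "x \<in> I" "x \<in> tail k" "x \<notin> null_ideal"
      obtain u v where uv: "u \<in> tail (Suc k)" "v \<in> tail (Suc k)" and x_eq: "x = u + e k * v"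
        using x(2) by (rule tail_Suc_decomp)
      \<comment> \<open>The inverse of \<open>e k\<close>, available because
        \<open>\<eta> k k\<close> is nonzero for \<open>k \<le> m\<close>.\<close>
      define g where "g = (1 / \<eta> k k) *s e k"
      have g: "e k * g = 1" "g * e k = 1"
        using generator_square[OF k(1)] nonnull[OF k(2)] by (simp_all add: g_def)
      have "e k * hat x = e k * hat u - e k * (e k * hat v)"
        using k(1) by (simp add: x_eq algebra_simps)
      also have "\<dots> = (u - e k * v) * e k"
        using generator_mult_hat_tail[OF k(1)] uv by (simp add: algebra_simps)
      finally have "e k * hat x * g = u - e k * v" using g(1) by (simp add: mult.assoc)
      then have "x + e k * hat x * g = u + u" by (simp add: x_eq)
      then have "u = (1 / 2) *s (x + e k * hat x * g)" using half_double by simp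
      then have u: "u \<in> I" using x(1) I(2-6) by auto
      have "v = g * (x - u)" using g(2) by (simp add: x_eq flip: mult.assoc)
      then have v: "v \<in> I" using x(1) u I(3,7) by auto
      have "u \<notin> null_ideal \<or> v \<notin> null_ideal" using x(3) R(2,3) unfolding x_eq by blast
      with step.IH[OF le_SucI[OF step.prems]] u v uv show "\<exists>y\<in>I. y \<in> units_in UNIV" by blast
    qed
  qed
  from this[of "Suc 0"] notsub that show thesis unfolding tail_one by auto
qed

text \<open>The radical is a graded ideal without units, which gives one inclusion; subtracting an
  element of \<open>null_ideal\<close> from 1 leaves a unit, which gives the other.\<close>

lemma jacobson_radical_eq: "jacobson_radical = null_ideal"
proof
  have "\<forall>x\<in>jacobson_radical. hat x \<in> jacobson_radical"
    using jacobson_involution[of hat] by simp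
  then have J: "graded_ideal jacobson_radical"
    unfolding graded_ideal_def
    using left_ideal_jacobson[unfolded left_ideal_def] by (simp add: jacobson_mult_right)
  show "jacobson_radical \<subseteq> null_ideal"
  proof (rule ccontr)
    assume "\<not> jacobson_radical \<subseteq> null_ideal"
    then obtain x :: 'a where "x \<in> jacobson_radical" "x \<in> units_in UNIV"
      by (rule graded_ideal_has_unit[OF J])
    then show False by (simp add: unit_notin_jacobson)
  qed
  have "left_ideal null_ideal"
    using graded_ideal_null by (simp add: graded_ideal_def left_ideal_def)
  moreover have "(1::'a) \<in> units_in UNIV" using scale_one_unit[of 1] by simp
  ultimately show "null_ideal \<subseteq> jacobson_radical"
    by (intro left_ideal_subset_jacobson unit_diff_null)
qed

section \<open>The pseudoscalar: commutation and annihilator\<close>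

definition pseudoscalar :: 'a
  where "pseudoscalar = basis_elem {1..n}"

lemma pseudoscalar_neq_0: "pseudoscalar \<noteq> 0"
proof
  assume "pseudoscalar = 0"
  moreover have "pseudoscalar \<in> basis_elem ` Pow {1..n}"
    unfolding pseudoscalar_def by (intro imageI) simp
  ultimately have "dependent (basis_elem ` Pow {1..n})" by (intro dependent_zero) simp
  with basis_elems_basis(1) show False ..
qed

lemma hat_pseudoscalar: "hat pseudoscalar = (- 1) ^ n *s pseudoscalar"
  unfolding pseudoscalar_def basis_elem_def by (subst hat_word) simp_all

text \<open>The ordered product is split at \<open>e a\<close>. From the right \<open>e a\<close>
  moves in past \<open>zs\<close>, from the left past \<open>ys\<close>; both times it contracts to
  \<open>\<eta> a a\<close>.\<close>

lemma pseudoscalar_mult_generator: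
  assumes a: "a \<in> {1..n}"
  shows "pseudoscalar * e a = (- 1) ^ Suc n *s (e a * pseudoscalar)"
    and "a \<in> {m<..n} \<Longrightarrow> pseudoscalar * e a = 0"
proof -
  obtain ys zs where split: "sorted_list_of_set {1..n} = ys @ a # zs"
    using split_list[of a "sorted_list_of_set {1..n}"] a by auto
  have "distinct (ys @ a # zs)" "set (ys @ a # zs) = {1..n}" "length (ys @ a # zs) = n"
    using split[symmetric] by simp_all
  then have yz: "set ys \<subseteq> {1..n}" "a \<notin> set ys" "set zs \<subseteq> {1..n}" "a \<notin> set zs"
    and len: "n = Suc (length ys + length zs)" by auto
  have ps: "pseudoscalar = word ys * (e a * word zs)"
    unfolding pseudoscalar_def basis_elem_def split by simp
  have "pseudoscalar * e a = word ys * (e a * (word zs * e a))" by (simp add: ps mult.assoc)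
  also have "\<dots> = word ys * (e a * (e a * hat (word zs)))"
    using generator_mult_hat_word[OF a yz(3,4)] by simp
  finally have right: "pseudoscalar * e a = (- 1) ^ length zs *s (\<eta> a a *s (word ys * word zs))"
    unfolding hat_word[OF yz(3)] by (simp add: generator_square[OF a] mult.assoc[of "e a" "e a", symmetric])
  \<comment> \<open>Applying \<open>hat\<close> to the swap rule shifts the \<open>hat\<close> to
    the other side, as needed for moving \<open>e a\<close> from left to right.\<close>
  have "hat (e a * hat (word ys)) = hat (word ys * e a)"
    using generator_mult_hat_word[OF a yz(1,2)] by simp
  then have "e a * word ys = hat (word ys) * e a" using a by simp
  then have "e a * pseudoscalar = hat (word ys) * (e a * (e a * word zs))"
    unfolding ps by (metis mult.assoc)
  then have left: "e a * pseudoscalar = (- 1) ^ length ys *s (\<eta> a a *s (word ys * word zs))"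
    unfolding hat_word[OF yz(1)] by (simp add: generator_square[OF a] mult.assoc[of "e a" "e a", symmetric])
  \<comment> \<open>As \<open>n = Suc (length ys + length zs)\<close>, the factor
    \<open>(- 1) ^ Suc n\<close> is the quotient of the two signs.\<close>
  have sign: "(- 1) ^ Suc n * (- 1) ^ length ys = ((- 1) ^ length zs :: 'f)"
    by (cases "even (length ys)"; cases "even (length zs)") (simp_all add: len)
  show "pseudoscalar * e a = (- 1) ^ Suc n *s (e a * pseudoscalar)"
    unfolding left right scale_scale[of "(- 1) ^ Suc n"] sign ..
  show "a \<in> {m<..n} \<Longrightarrow> pseudoscalar * e a = 0" by (simp add: right null)
qed

text \<open>Both sides respect products, so the sign \<open>(- 1) ^ Suc n\<close> on generators
  decides: it is 1 for odd \<open>n\<close> and that of \<open>hat\<close> for even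
  \<open>n\<close>.\<close>

lemma pseudoscalar_commute:
  "pseudoscalar * x = (if odd n then x else hat x) * pseudoscalar"
proof (induction x rule: algebra_induct)
  case subspace
  show ?case by (auto simp: subspace_def distrib_left distrib_right)
next
  case (mult x y)
  have "pseudoscalar * (x * y) = pseudoscalar * x * y" by (simp add: mult.assoc)
  also have "\<dots> = (if odd n then x else hat x) * (pseudoscalar * y)"
    unfolding mult(1) by (simp add: mult.assoc)
  finally show ?case unfolding mult(2) by (simp add: mult.assoc)
next
  case (generator a)
  then show ?case using pseudoscalar_mult_generator(1)[OF generator] by (auto simp: algebra_simps)
qed simp

text \<open>By the commutation rule the annihilator is a graded two-sided ideal. It contains no
  unit, as the pseudoscalar is nonzero, so it lies in \<open>null_ideal\<close>; conversely every
  null generator is annihilated.\<close>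

lemma pseudoscalar_annihilator: "pseudoscalar * x = 0 \<longleftrightarrow> x \<in> null_ideal"
proof -
  let ?I = "{x. pseudoscalar * x = 0}"
  have "graded_ideal ?I"
    unfolding graded_ideal_def
  proof (intro conjI ballI allI)
    fix x assume x: "x \<in> ?I"
    show "a * x \<in> ?I" for a
      using x pseudoscalar_commute[of a] by (simp add: mult.assoc flip: mult.assoc[of pseudoscalar])
    have "hat (pseudoscalar * x) = 0" using x by simp
    then show "hat x \<in> ?I" by (simp add: hat_pseudoscalar)
    show "x * a \<in> ?I" for a using x by (simp flip: mult.assoc)
  qed (simp_all add: distrib_left)
  then have "?I \<subseteq> null_ideal"
  proof (rule contrapos_pp)
    assume "\<not> ?I \<subseteq> null_ideal"
    show "\<not> graded_ideal ?I"
    proof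
      assume "graded_ideal ?I"
      then obtain u where "u \<in> ?I" "u \<in> units_in UNIV"
        using graded_ideal_has_unit \<open>\<not> ?I \<subseteq> null_ideal\<close> by blast
      then have "pseudoscalar * (u * inv_of u) = 0" by (simp flip: mult.assoc)
      then show False using pseudoscalar_neq_0 \<open>u \<in> units_in UNIV\<close> by (simp add: inv_of_unit)
    qed
  qed
  moreover have "pseudoscalar * (\<Sum>z\<in>{m<..n}. e z * u z) = 0" for u
    using pseudoscalar_mult_generator(2)
    by (auto simp: sum_distrib_left intro!: sum.neutral simp flip: mult.assoc)
  then have "null_ideal \<subseteq> ?I" by (auto simp: null_ideal_def)
  ultimately show ?thesis by blast
qed

section \<open>Grades 0 and n as lines, and maps stabilising a line\<close>

lemma grade_0: "grade 0 = span {1}"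
proof -
  \<comment> \<open>\<open>card\<close> is also 0 on infinite sets, so the finiteness of
    \<open>A\<close> enters.\<close>
  have "A \<subseteq> {1..n} \<and> card A = 0 \<longleftrightarrow> A = {}" for A
    using finite_subset[of A "{1..n}"] by auto
  then show ?thesis by (simp add: grade_def basis_elem_def)
qed

lemma grade_top: "grade n = span {pseudoscalar}"
proof -
  have "A \<subseteq> {1..n} \<and> card A = n \<longleftrightarrow> A = {1..n}" for A
    using card_subset_eq[of "{1..n}" A] by auto
  then show ?thesis by (simp add: grade_def pseudoscalar_def)
qed

text \<open>Multiplication by \<open>T\<close> on the right clears the inverse. Keeping
  \<open>X\<close> separate covers \<open>ad\<close> with \<open>X = T\<close> and
  \<open>ad_check\<close> with \<open>X = hat T\<close>.\<close>

lemma stabilises_line_iff: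
  assumes T: "T \<in> units_in UNIV"
  shows "(\<lambda>U. X * U * inv_of T) ` span {w} \<subseteq> span {w} \<longleftrightarrow> (\<exists>c. X * w = c *s (w * T))"
proof
  assume "(\<lambda>U. X * U * inv_of T) ` span {w} \<subseteq> span {w}"
  then have "X * w * inv_of T \<in> span {w}" by (auto intro: span_base)
  then obtain c where "X * w * inv_of T = c *s w" by (auto simp: span_singleton)
  then have "X * w * inv_of T * T = c *s w * T" by simp
  then show "\<exists>c. X * w = c *s (w * T)" using T by (auto simp: mult.assoc inv_of_unit)
next
  assume "\<exists>c. X * w = c *s (w * T)"
  then obtain c where c: "X * w = c *s (w * T)" ..
  have "X * w * inv_of T = c *s w" using T by (simp add: c mult.assoc inv_of_unit)
  then show "(\<lambda>U. X * U * inv_of T) ` span {w} \<subseteq> span {w}"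
    by (auto simp: span_singleton mult.assoc)
qed

lemma double_eq_0_iff: "(x::'a) + x = 0 \<longleftrightarrow> x = 0"
  using half_double[of x] by auto

text \<open>Uniqueness, here and in the odd case: an element that is both even and odd is its own
  negative, hence 0.\<close>

lemma even_part_even:
  assumes "hat U = U"
  shows "even_part U = U"
  unfolding even_part_def
proof (rule the_equality)
  show "V = U" if "V \<in> parity_subspace 0 \<and> U - V \<in> parity_subspace 1" for V
    using that assms double_eq_0_iff[of "U - V"] by (simp add: parity_subspace_def algebra_simps)
qed (simp add: parity_subspace_def assms)

lemma even_part_odd:
  assumes "hat U = - U"
  shows "even_part U = 0"
  unfolding even_part_def
proof (rule the_equality)
  show "V = 0" if "V \<in> parity_subspace 0 \<and> U - V \<in> parity_subspace 1" for V
  proof -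
    have "hat V = V" "- hat V = V" using that assms by (auto simp: parity_subspace_def)
    then have "- V = V" by metis
    then have "V + V = 0" using add.right_inverse[of V] by simp
    then show "V = 0" by (simp only: double_eq_0_iff)
  qed
qed (simp add: parity_subspace_def assms)

text \<open>On a set of a single parity one of the two summands of \<open>ad_tilde\<close> vanishes.
  Grades 0 and \<open>n\<close> are such sets.\<close>

lemma ad_tilde_image:
  assumes "\<And>U. U \<in> S \<Longrightarrow> hat U = (- 1) ^ k *s U"
  shows "ad_tilde T ` S = (if even k then ad T else ad_check T) ` S"
proof (rule image_cong[OF refl])
  fix U assume "U \<in> S"
  from assms[OF this] show "ad_tilde T U = (if even k then ad T else ad_check T) U"
    by (auto simp: ad_tilde_def ad_def ad_check_def odd_part_def even_part_even even_part_odd)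
qed

section \<open>Elements of pure parity, exactly or modulo the radical\<close>

lemma hat_eigen_parity:
  assumes V: "subspace V" "\<And>x. x \<in> V \<Longrightarrow> hat x \<in> V" and T: "hat T - c *s T \<in> V"
  shows "T + hat T \<in> V \<or> T - hat T \<in> V"
proof (cases "c = 1")
  case True
  with subspace_neg[OF V(1) T] show ?thesis by simp
next
  case False
  \<comment> \<open>The sum equals \<open>(1 - c) *s (T + hat T)\<close>, and \<open>1 - c\<close>
    can be divided out; for \<open>c = 1\<close> the hypothesis was already the other
    alternative.\<close>
  have "(hat T - c *s T) + hat (hat T - c *s T) \<in> V"
    by (intro subspace_add V T)
  then have "(1 - c) *s (T + hat T) \<in> V"
    by (simp add: algebra_simps)
  from subspace_scale[OF V(1) this, of "1 / (1 - c)"] False show ?thesis by simp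
qed

lemma Ppm_iff: "T \<in> Ppm \<longleftrightarrow> T \<in> units_in UNIV \<and> (hat T = T \<or> hat T = - T)"
  by (auto simp: Ppm_def parity_subspace_def units_in_def)

lemma hat_eigen_iff_Ppm:
  assumes T: "T \<in> units_in UNIV"
  shows "(\<exists>c. hat T = c *s T) \<longleftrightarrow> T \<in> Ppm"
proof
  assume "\<exists>c. hat T = c *s T"
  \<comment> \<open>Equality is written as membership in the zero subspace, the choice of
    \<open>V\<close> for exact parity.\<close>
  then obtain c where "hat T - c *s T \<in> {0}" by auto
  then have "T + hat T \<in> {0} \<or> T - hat T \<in> {0}"
    by (rule hat_eigen_parity[rotated 2]) (auto simp: subspace_def)
  then show "T \<in> Ppm"
    unfolding Ppm_iff using T by (auto simp: eq_neg_iff_add_eq_0 add.commute)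
next
  assume "T \<in> Ppm"
  then have "hat T = 1 *s T \<or> hat T = (- 1) *s T"
    unfolding Ppm_iff by auto
  then show "\<exists>c. hat T = c *s T" by blast
qed

lemma hat_eigen_mod_null_iff_Ppm_rad:
  "T \<in> units_in UNIV \<and> (\<exists>c. hat T - c *s T \<in> null_ideal) \<longleftrightarrow> T \<in> Ppm_rad"
proof
  note R = graded_idealD[OF graded_ideal_null]
  assume "T \<in> units_in UNIV \<and> (\<exists>c. hat T - c *s T \<in> null_ideal)"
  then obtain c where T: "T \<in> units_in UNIV" and c: "hat T - c *s T \<in> null_ideal" by blast
  \<comment> \<open>\<open>S\<close> stands for the odd or the even half of \<open>T\<close>. It
    differs from the unit \<open>T\<close> by an element of \<open>null_ideal\<close>, so it is a
    unit, and \<open>inv_of S * T\<close> is 1 plus an element of the ideal.\<close>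
  have main: "T \<in> Ppm_rad" if "T - S \<in> null_ideal" "hat S = S \<or> hat S = - S" for S
  proof -
    have "T - (T - S) \<in> units_in UNIV" by (rule unit_diff_null[OF T that(1)])
    then have S: "S \<in> units_in UNIV" by simp
    with that(2) have "S \<in> Ppm" unfolding Ppm_iff by blast
    moreover have "inv_of S * T \<in> units_in (grade 0 + jacobson_radical)"
    proof -
      have "inv_of S * T = 1 + inv_of S * (T - S)"
        using S by (simp add: right_diff_distrib inv_of_unit)
      moreover have "1 \<in> grade 0" by (simp add: grade_0 span_base)
      moreover have "inv_of S * (T - S) \<in> jacobson_radical"
        unfolding jacobson_radical_eq by (rule R(3)[OF that(1)])
      ultimately have "inv_of S * T \<in> grade 0 + jacobson_radical" by (metis set_plus_intro)
      then show ?thesis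
        using unit_mult[OF unit_inv_of[OF S] T] units_in_iff by blast
    qed
    moreover have "T = S * (inv_of S * T)" using S by (simp add: unit_mult_inv_assoc)
    ultimately show ?thesis unfolding Ppm_rad_def by (metis set_times_intro)
  qed
  from hat_eigen_parity[OF R(8,5) c] show "T \<in> Ppm_rad"
  proof
    assume "T + hat T \<in> null_ideal"
    \<comment> \<open>The even half lies in the ideal, so \<open>T\<close> agrees with its odd half
      modulo \<open>null_ideal\<close>.\<close>
    then have "(1 / 2) *s (T + hat T) \<in> null_ideal" by (rule R(6))
    moreover have "(1 / 2) *s (T + hat T) = T - (1 / 2) *s (T - hat T)"
      using half_double[of T] by (simp add: scale_right_distrib scale_right_diff_distrib algebra_simps)
    ultimately show ?thesis
      by (intro main[of "(1 / 2) *s (T - hat T)"]) (simp_all add: scale_right_diff_distrib)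
  next
    assume "T - hat T \<in> null_ideal"
    then have "(1 / 2) *s (T - hat T) \<in> null_ideal" by (rule R(6))
    moreover have "(1 / 2) *s (T - hat T) = T - (1 / 2) *s (T + hat T)"
      using half_double[of T] by (simp add: scale_right_distrib scale_right_diff_distrib algebra_simps)
    ultimately show ?thesis
      by (intro main[of "(1 / 2) *s (T + hat T)"]) (simp_all add: add.commute)
  qed
next
  note R = graded_idealD[OF graded_ideal_null]
  assume "T \<in> Ppm_rad"
  then obtain S v where T: "T = S * v" and S: "S \<in> Ppm"
    and v: "v \<in> units_in (grade 0 + jacobson_radical)"
    unfolding Ppm_rad_def by (rule set_times_elim)
  have units: "S \<in> units_in UNIV" "v \<in> units_in UNIV"
    using S v unfolding Ppm_iff units_in_iff[of _ "grade 0 + _"] by auto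
  from v have "v \<in> grade 0 + jacobson_radical" using units_in_iff by blast
  then obtain b \<rho> where v_eq: "v = b *s 1 + \<rho>" and \<rho>: "\<rho> \<in> null_ideal"
    by (auto elim!: set_plus_elim simp: grade_0 span_singleton jacobson_radical_eq)
  obtain c where c: "hat S = c *s S" using S hat_eigen_iff_Ppm[OF units(1)] by blast
  \<comment> \<open>Since \<open>hat S = c *s S\<close> and \<open>hat\<close> fixes the scalar part
    of \<open>v\<close>, only the part \<open>\<rho>\<close> in the ideal contributes.\<close>
  have "hat T - c *s T = c *s (S * (hat \<rho> - \<rho>))"
    by (simp add: T c v_eq algebra_simps)
  also have "\<dots> \<in> null_ideal" using \<rho> by (intro R(3,5,6,7))
  finally show "T \<in> units_in UNIV \<and> (\<exists>c. hat T - c *s T \<in> null_ideal)"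
    using unit_mult[OF units] T by blast
qed

section \<open>The stabilisers of grades 0 and n\<close>

lemma hat_grade_0: "U \<in> grade 0 \<Longrightarrow> hat U = (- 1) ^ 0 *s U"
  by (auto simp: grade_0 span_singleton)

lemma hat_grade_top: "U \<in> grade n \<Longrightarrow> hat U = (- 1) ^ n *s U"
  by (auto simp: grade_top span_singleton hat_pseudoscalar mult.commute)

lemma ad_tilde_grade_0: "ad_tilde T ` grade 0 = ad T ` grade 0"
  using ad_tilde_image[of "grade 0" 0 T, OF hat_grade_0] by simp

lemma ad_tilde_grade_top: "ad_tilde T ` grade n = (if even n then ad T else ad_check T) ` grade n"
  by (rule ad_tilde_image[OF hat_grade_top])

lemma Gam_0: "Gam 0 = units_in UNIV"
proof -
  have "ad T ` grade 0 \<subseteq> grade 0" if "T \<in> units_in UNIV" for T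
    unfolding ad_def grade_0 stabilises_line_iff[OF that] by (auto intro: exI[of _ 1])
  then show ?thesis by (auto simp: Gam_def)
qed

lemma Gam_tilde_0: "Gam_tilde 0 = units_in UNIV"
  using Gam_0 unfolding Gam_def Gam_tilde_def ad_tilde_grade_0 .

lemma Gam_check_0: "Gam_check 0 = Ppm"
proof -
  have "ad_check T ` grade 0 \<subseteq> grade 0 \<longleftrightarrow> T \<in> Ppm" if "T \<in> units_in UNIV" for T
    unfolding ad_check_def grade_0 stabilises_line_iff[OF that]
    using hat_eigen_iff_Ppm[OF that] by simp
  moreover have "Ppm \<subseteq> units_in UNIV" by (auto simp: Ppm_iff)
  ultimately show ?thesis unfolding Gam_check_def by blast
qed

text \<open>The pseudoscalar cancels up to its annihilator. This covers \<open>Gam n\<close> for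
  even \<open>n\<close> and \<open>Gam_check n\<close> for odd \<open>n\<close>, where commuting to
  the left leaves exactly one \<open>hat\<close>.\<close>

lemma twisted_stabiliser:
  "{T \<in> units_in UNIV. \<exists>c. pseudoscalar * hat T = c *s (pseudoscalar * T)} = Ppm_rad"
proof -
  have "pseudoscalar * hat T = c *s (pseudoscalar * T) \<longleftrightarrow> hat T - c *s T \<in> null_ideal" for T c
    by (simp add: right_diff_distrib flip: pseudoscalar_annihilator)
  then show ?thesis using hat_eigen_mod_null_iff_Ppm_rad by auto
qed

lemma Gam_top: "Gam n = (if odd n then units_in UNIV else Ppm_rad)"
proof -
  have "Gam n = {T \<in> units_in UNIV. \<exists>c. T * pseudoscalar = c *s (pseudoscalar * T)}"
    unfolding Gam_def ad_def grade_top using stabilises_line_iff by blast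
  also have "\<dots> = (if odd n then units_in UNIV else Ppm_rad)"
  proof (cases "odd n")
    case True
    then have "T * pseudoscalar = 1 *s (pseudoscalar * T)" for T
      using pseudoscalar_commute[of T] by simp
    then have "\<exists>c. T * pseudoscalar = c *s (pseudoscalar * T)" for T by blast
    with True show ?thesis by simp
  next
    case False
    then have "T * pseudoscalar = pseudoscalar * hat T" for T
      using pseudoscalar_commute[of "hat T"] by simp
    with False twisted_stabiliser show ?thesis by simp
  qed
  finally show ?thesis .
qed

text \<open>The additional \<open>hat\<close> in \<open>ad_check\<close> exchanges the roles that
  even and odd \<open>n\<close> have for \<open>Gam n\<close>.\<close>

lemma Gam_check_top: "Gam_check n = (if odd n then Ppm_rad else units_in UNIV)"
proof -
  have "Gam_check n = {T \<in> units_in UNIV. \<exists>c. hat T * pseudoscalar = c *s (pseudoscalar * T)}"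
    unfolding Gam_check_def ad_check_def grade_top using stabilises_line_iff by blast
  also have "\<dots> = (if odd n then Ppm_rad else units_in UNIV)"
  proof (cases "odd n")
    case True
    then have "hat T * pseudoscalar = pseudoscalar * hat T" for T
      using pseudoscalar_commute[of "hat T"] by simp
    with True twisted_stabiliser show ?thesis by simp
  next
    case False
    then have "hat T * pseudoscalar = 1 *s (pseudoscalar * T)" for T
      using pseudoscalar_commute[of T] by simp
    then have "\<exists>c. hat T * pseudoscalar = c *s (pseudoscalar * T)" for T by blast
    with False show ?thesis by simp
  qed
  finally show ?thesis .
qed

text \<open>Grade \<open>n\<close> has the parity of \<open>n\<close>, so \<open>ad_tilde\<close>
  acts as \<open>ad\<close> for even and as \<open>ad_check\<close> for odd \<open>n\<close>: in
  both cases the twisted one.\<close>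

lemma Gam_tilde_top: "Gam_tilde n = Ppm_rad"
  using Gam_top Gam_check_top
  unfolding Gam_def Gam_check_def Gam_tilde_def ad_tilde_grade_top
  by (cases "odd n") simp_all

lemmas stabilisers =
  Gam_0 Gam_tilde_0 Gam_check_0 Gam_top Gam_check_top Gam_tilde_top

end

theorem theorem7p1:
  fixes p q r n :: nat
  assumes "n = p + q + r" and "n \<ge> 1"
  shows "(\<forall>(scale :: real \<Rightarrow> 'a::ring_1 \<Rightarrow> 'a) e.
      geometric_algebra scale n (eta_real p q) e \<longrightarrow>
        (geometric_algebra.Gam scale n e 0 = units_in UNIV \<and>
         geometric_algebra.Gam_tilde scale n e 0 = units_in UNIV) \<and>
        (odd n \<longrightarrow> geometric_algebra.Gam scale n e n = units_in UNIV) \<and>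
        (even n \<longrightarrow>
          geometric_algebra.Gam scale n e n = geometric_algebra.Ppm_rad scale n e \<and>
          geometric_algebra.Gam_tilde scale n e n = geometric_algebra.Ppm_rad scale n e) \<and>
        geometric_algebra.Gam_check scale n e 0 = geometric_algebra.Ppm scale n e \<and>
        (odd n \<longrightarrow>
          geometric_algebra.Gam_check scale n e n = geometric_algebra.Ppm_rad scale n e \<and>
          geometric_algebra.Gam_tilde scale n e n = geometric_algebra.Ppm_rad scale n e) \<and>
        (even n \<longrightarrow> geometric_algebra.Gam_check scale n e n = units_in UNIV))
    \<and>
    (\<forall>(scale :: complex \<Rightarrow> 'b::ring_1 \<Rightarrow> 'b) e.
      geometric_algebra scale n (eta_complex p q) e \<longrightarrow>
        (geometric_algebra.Gam scale n e 0 = units_in UNIV \<and>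
         geometric_algebra.Gam_tilde scale n e 0 = units_in UNIV) \<and>
        (odd n \<longrightarrow> geometric_algebra.Gam scale n e n = units_in UNIV) \<and>
        (even n \<longrightarrow>
          geometric_algebra.Gam scale n e n = geometric_algebra.Ppm_rad scale n e \<and>
          geometric_algebra.Gam_tilde scale n e n = geometric_algebra.Ppm_rad scale n e) \<and>
        geometric_algebra.Gam_check scale n e 0 = geometric_algebra.Ppm scale n e \<and>
        (odd n \<longrightarrow>
          geometric_algebra.Gam_check scale n e n = geometric_algebra.Ppm_rad scale n e \<and>
          geometric_algebra.Gam_tilde scale n e n = geometric_algebra.Ppm_rad scale n e) \<and>
        (even n \<longrightarrow> geometric_algebra.Gam_check scale n e n = units_in UNIV))"
proof (intro conjI[of "All _"] allI impI)
  fix scale :: "real \<Rightarrow> 'a \<Rightarrow> 'a" and e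
  assume "geometric_algebra scale n (eta_real p q) e"
  then interpret geometric_algebra scale n "eta_real p q" e .
  \<comment> \<open>With \<open>m = p + q\<close> the diagonal entries are 1 or -1 up to
    \<open>m\<close> and 0 at the last \<open>r\<close> indices.\<close>
  interpret diagonal_geometric_algebra scale n "eta_real p q" e "p + q"
    by unfold_locales (auto simp: eta_real_def assms(1))
  show "(Gam 0 = units_in UNIV \<and> Gam_tilde 0 = units_in UNIV) \<and>
    (odd n \<longrightarrow> Gam n = units_in UNIV) \<and>
    (even n \<longrightarrow> Gam n = Ppm_rad \<and> Gam_tilde n = Ppm_rad) \<and>
    Gam_check 0 = Ppm \<and>
    (odd n \<longrightarrow> Gam_check n = Ppm_rad \<and> Gam_tilde n = Ppm_rad) \<and>
    (even n \<longrightarrow> Gam_check n = units_in UNIV)"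
    by (simp add: stabilisers)
next
  fix scale :: "complex \<Rightarrow> 'b \<Rightarrow> 'b" and e
  assume "geometric_algebra scale n (eta_complex p q) e"
  then interpret geometric_algebra scale n "eta_complex p q" e .
  interpret diagonal_geometric_algebra scale n "eta_complex p q" e "p + q"
    by unfold_locales (auto simp: eta_complex_def assms(1))
  show "(Gam 0 = units_in UNIV \<and> Gam_tilde 0 = units_in UNIV) \<and>
    (odd n \<longrightarrow> Gam n = units_in UNIV) \<and>
    (even n \<longrightarrow> Gam n = Ppm_rad \<and> Gam_tilde n = Ppm_rad) \<and>
    Gam_check 0 = Ppm \<and>
    (odd n \<longrightarrow> Gam_check n = Ppm_rad \<and> Gam_tilde n = Ppm_rad) \<and>
    (even n \<longrightarrow> Gam_check n = units_in UNIV)"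
    by (simp add: stabilisers)
qed

end
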